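(* Let $h\ge 0$ and $k\ge1$ be integers, $s_\Sigma=2(1-h)/k$, and let $k_1<0$, $k_2\ne0$ be real numbers. For sufficiently small cone angle $2\pi\beta_0$, $0<\beta_0\le1$, and sufficiently large $k'>0$, with $x=\frac{k}{k+k'}$, the coupling constant $$\alpha=\frac{\sqrt{4k_1^2+(1-k_1^2+k_2^2)^2}}{2\,(1+(k_1-k_2)^2)\,k_2^2}\cdot\frac{3+x+s_\Sigma x^2-3(1+x)\beta_0}{x}$$ for which the coupled dHYM/scalar curvature equations are solved (by the momentum construction) on the ruled surface $X=\mathbb P(\mathcal L\oplus\mathcal O)\to\Sigma$, with cone angle $2\pi\beta_0$ along the zero section, is positive.
   Context: $\Sigma$ is a compact Riemann surface of genus $h$ and $\mathcal L\to\Sigma$ a holomorphic line bundle of degree $k>0$. The quantity $\alpha$ is the unique value of the coupling constant for which the coupled equations $\Theta_\omega(F)=\hat\theta$ mod $2\pi$, $s(\omega)-\alpha r_\omega(F)=\hat s-\alpha\hat r$ are solved by a pair $(\omega,F)$ given by the momentum construction (Calabi ansatz) on $X$, in the classes $[\omega]=2\pi[2E_0+k'C]$, $[F]=2\pi[2(k_1-k_2)E_0+(2kk_2+k'(k_1+k_2))C]$ ($E_0$ the zero section, $C$ a fibre), where $\omega$ has cone angle $2\pi\beta_0$ along the zero section and $2\pi\beta_\infty$, $\beta_\infty=\frac{-2+\beta_0(1+x)}{-1+x}$, along the infinity section, whenever $1+(k_1+k_2)^2>x(1+(k_1-k_2)^2)$. Here, with $\lambda_i$ the eigenvalues of $\omega^{-1}F$,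 $\Theta_\omega(F)=-\sum_i\arctan\lambda_i$, $r_\omega(F)=\prod_i(1+\lambda_i^2)^{1/2}$, $s(\omega)$ is the scalar curvature, and $\hat\theta,\hat s,\hat r$ are the corresponding cohomological constants. For the claim only the explicit formula for $\alpha$ is needed. *)

theory Defs
  imports Complex_Main
begin

text \<open>
  Setting: \<open>X = P(L \<oplus> O)\<close> is the ruled surface over a compact Riemann surface of genus \<open>h\<close>, with
  \<open>L\<close> of degree \<open>k > 0\<close>. With \<open>E\<^sub>0\<close> the zero section and \<open>C\<close> a fibre, the classes are
  \<open>[\<omega>] = 2\<pi>[2 E\<^sub>0 + k' C]\<close> and
  \<open>[F] = 2\<pi>[2 (k\<^sub>1 - k\<^sub>2) E\<^sub>0 + (2 k k\<^sub>2 + k' (k\<^sub>1 + k\<^sub>2)) C]\<close>; the cone angle of \<open>\<omega>\<close> along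
  \<open>E\<^sub>0\<close> is \<open>2\<pi>\<beta>\<^sub>0\<close>. The degree, \<open>k'\<close> and the genus enter as reals through \<open>x\<close> and \<open>s\<^sub>\<Sigma>\<close>.
\<close>

definition momentum_x :: "nat \<Rightarrow> real \<Rightarrow> real" where
  "momentum_x k k' = real k / (real k + k')"

definition base_scalar_curvature :: "nat \<Rightarrow> nat \<Rightarrow> real" where
  "base_scalar_curvature h k = 2 * (1 - real h) / real k"

text \<open>
  The condition under which the momentum construction produces a pair \<open>(\<omega>, F)\<close> solving
  \<open>\<Theta>\<^sub>\<omega>(F) = \<theta>\<close> mod \<open>2\<pi>\<close>, \<open>s(\<omega>) - \<alpha> r\<^sub>\<omega>(F) = s - \<alpha> r\<close> (with topological constants \<open>\<theta>, s, r\<close>)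
  in the classes above.
\<close>

definition momentum_solvable :: "real \<Rightarrow> real \<Rightarrow> real \<Rightarrow> bool" where
  "momentum_solvable x k1 k2 \<longleftrightarrow> 1 + (k1 + k2)\<^sup>2 > x * (1 + (k1 - k2)\<^sup>2)"

text \<open>
  The value of \<open>\<alpha>\<close> for which the momentum construction solves these equations, given by its closed
  form. The equations on \<open>X\<close> are not themselves formalised.
\<close>

definition coupling_constant ::
    "nat \<Rightarrow> nat \<Rightarrow> real \<Rightarrow> real \<Rightarrow> real \<Rightarrow> real \<Rightarrow> real" where
  "coupling_constant h k k1 k2 k' \<beta>\<^sub>0 =
     (let x = momentum_x k k'; s = base_scalar_curvature h k in
        sqrt (4 * k1\<^sup>2 + (1 - k1\<^sup>2 + k2\<^sup>2)\<^sup>2) / (2 * (1 + (k1 - k2)\<^sup>2) * k2\<^sup>2)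
        * ((3 + x + s * x\<^sup>2 - 3 * (1 + x) * \<beta>\<^sub>0) / x))"

end

theory Submission
  imports Defs
begin

text \<open>
  Everything is governed by the smallness of \<open>x = k / (k + k')\<close>, which lies in \<open>(0, 1)\<close> and tends to
  \<open>0\<close> as \<open>k'\<close> grows. At \<open>x = 0\<close> the solvability condition reads \<open>1 + (k\<^sub>1 + k\<^sub>2)\<^sup>2 > 0\<close>, and the only
  factor of \<open>\<alpha>\<close> whose sign can vary has numerator \<open>3 - 3\<beta>\<^sub>0\<close>, positive for any cone angle below
  \<open>2\<pi>\<close>. Hence both claims persist for small \<open>x\<close>, uniformly in \<open>\<beta>\<^sub>0\<close> once \<open>\<beta>\<^sub>0\<close> stays away from \<open>1\<close>.

  To make this quantitative with one threshold, put \<open>c = 1 + \<bar>s\<^sub>\<Sigma>\<bar> + (k\<^sub>1 - k\<^sub>2)\<^sup>2\<close>. Then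
  \<open>k' > k c\<close> forces \<open>x c < 1\<close>, and this single inequality bounds \<open>x\<close>, \<open>x \<bar>s\<^sub>\<Sigma>\<bar>\<close> and
  \<open>x (1 + (k\<^sub>1 - k\<^sub>2)\<^sup>2)\<close> all by \<open>1\<close>.
\<close>

lemma momentum_x_pos:
  assumes "k \<ge> 1" "k' > 0"
  shows "momentum_x k k' > 0"
  using assms by (simp add: momentum_x_def add_pos_pos)

lemma momentum_x_mult_less_1:
  assumes "k' > 0" "k' > real k * c"
  shows "momentum_x k k' * c < 1"
proof -
  have "real k + k' > 0" using assms by simp
  then show ?thesis using assms by (simp add: momentum_x_def divide_simps)
qed

text \<open>
  For \<open>\<beta> < 1/2\<close> the linear part of the numerator exceeds \<open>3/2 - x/2 > 1\<close>, while the curvature term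
  is at least \<open>-(x \<bar>s\<bar>) x > -1\<close>; the bound \<open>1/2\<close> on the angle is thus uniform in the genus.
\<close>

lemma curvature_factor_pos:
  fixes x s \<beta> :: real
  assumes "0 < x" "x < 1" "x * \<bar>s\<bar> < 1" "\<beta> < 1/2"
  shows "3 + x + s * x\<^sup>2 - 3 * (1 + x) * \<beta> > 0"
proof -
  have "(1 + x) * \<beta> < (1 + x) * (1/2)"
    using assms by (intro mult_strict_left_mono) auto
  moreover have "\<bar>s * x\<^sup>2\<bar> < 1"
  proof -
    have "\<bar>s * x\<^sup>2\<bar> = (x * \<bar>s\<bar>) * x"
      using assms by (simp add: abs_mult power2_eq_square)
    also have "\<dots> < 1"
      using mult_strict_mono[of "x * \<bar>s\<bar>" 1 x 1] assms by simp
    finally show ?thesis .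
  qed
  ultimately show ?thesis using assms(2) by (simp add: algebra_simps abs_less_iff)
qed

lemma coupling_prefactor_pos:
  fixes k1 k2 :: real
  assumes "k1 \<noteq> 0" "k2 \<noteq> 0"
  shows "sqrt (4 * k1\<^sup>2 + (1 - k1\<^sup>2 + k2\<^sup>2)\<^sup>2) / (2 * (1 + (k1 - k2)\<^sup>2) * k2\<^sup>2) > 0"
proof -
  have "4 * k1\<^sup>2 + (1 - k1\<^sup>2 + k2\<^sup>2)\<^sup>2 > 0"
    using assms by (intro add_pos_nonneg) auto
  moreover have "1 + (k1 - k2)\<^sup>2 > 0"
    by (intro add_pos_nonneg) auto
  ultimately show ?thesis using assms by simp
qed

theorem corollary4:
  fixes h k :: nat and k1 k2 :: real
  assumes "k \<ge> 1" and "k1 < 0" and "k2 \<noteq> 0"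
  shows "\<exists>b>0. \<exists>K>0. \<forall>\<beta>\<^sub>0 k'. 0 < \<beta>\<^sub>0 \<and> \<beta>\<^sub>0 \<le> 1 \<and> \<beta>\<^sub>0 < b \<and> k' > K \<longrightarrow>
           momentum_solvable (momentum_x k k') k1 k2 \<and>
           coupling_constant h k k1 k2 k' \<beta>\<^sub>0 > 0"
proof -
  define s where "s = base_scalar_curvature h k"
  define c where "c = 1 + \<bar>s\<bar> + (k1 - k2)\<^sup>2"
  have c: "1 \<le> c" "\<bar>s\<bar> \<le> c" "1 + (k1 - k2)\<^sup>2 \<le> c"
    by (simp_all add: c_def)
  have K: "real k * c > 0" using assms(1) c(1) by simp
  have main: "momentum_solvable (momentum_x k k') k1 k2 \<and> coupling_constant h k k1 k2 k' \<beta>\<^sub>0 > 0"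
    if "\<beta>\<^sub>0 < 1/2" "k' > real k * c" for \<beta>\<^sub>0 k'
  proof
    define x where "x = momentum_x k k'"
    have "k' > 0" using K that(2) by linarith
    then have x: "x > 0" and xc: "x * c < 1"
      using momentum_x_pos momentum_x_mult_less_1 assms(1) that(2) by (auto simp: x_def)
    have small: "x * y < 1" if "y \<le> c" for y
      using mult_left_mono[OF that, of x] x xc by linarith
    have "x * (1 + (k1 - k2)\<^sup>2) < 1 + (k1 + k2)\<^sup>2"
      using small[OF c(3)] by (rule less_le_trans) simp
    then show "momentum_solvable (momentum_x k k') k1 k2"
      by (simp add: momentum_solvable_def x_def)
    have "3 + x + s * x\<^sup>2 - 3 * (1 + x) * \<beta>\<^sub>0 > 0"
      using curvature_factor_pos[OF x] small[OF c(1)] small[OF c(2)] that(1) by simp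
    then show "coupling_constant h k k1 k2 k' \<beta>\<^sub>0 > 0"
      using coupling_prefactor_pos[of k1 k2] assms x
      unfolding coupling_constant_def Let_def x_def[symmetric] s_def[symmetric]
      by (intro mult_pos_pos divide_pos_pos[of _ x]) auto
  qed
  show ?thesis
    using main K by (intro exI[of _ "1/2"] exI[of _ "real k * c"] conjI) auto
qed

end
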